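(* Let $\mathscr{H}$ be a complex Hilbert space and let $A\in\mathbb{B}(\mathscr{H})$. Then: (i) $w(A)=\frac{1}{2}\|A\|$ if and only if $w(A+\lambda I)=\frac{1}{2}\|A\|+|\lambda|$ for all $\lambda\in\mathbb{C}$; (ii) $w(A)=\frac{1}{2}\sqrt{\|A^*A+AA^*\|}$ if and only if $w(A+\lambda I)=\frac{1}{2}\sqrt{\|A^*A+AA^*\|}+|\lambda|$ for all $\lambda\in\mathbb{C}$.
   Context: $\mathbb{B}(\mathscr{H})$ is the algebra of all bounded linear operators on the complex Hilbert space $\mathscr{H}$, with identity operator $I$, and $\|\cdot\|$ is the operator norm. For $T\in\mathbb{B}(\mathscr{H})$, the numerical radius is $w(T)=\sup\{|\langle Tx,x\rangle|: x\in\mathscr{H},\ \|x\|=1\}$. *)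

theory Defs
  imports "HOL-Analysis.Analysis"
begin

text \<open>
  A complex inner product space is built on top of the library class for real inner product
  spaces: the real scalar product is the real part of the complex one. Hence the inherited
  norm is \<open>norm x = sqrt (Re (cinner x x))\<close>, and positivity and definiteness of
  \<open>cinner\<close> are the inherited axioms \<open>inner_ge_zero\<close> and \<open>inner_eq_zero_iff\<close>
  (\<open>cinner x x\<close> is real by \<open>cinner_commute\<close>).
\<close>

class complex_vector = real_vector +
  fixes scaleC :: "complex \<Rightarrow> 'a \<Rightarrow> 'a"  (infixr "*\<^sub>C" 75)
  assumes scaleC_add_right: "a *\<^sub>C (x + y) = a *\<^sub>C x + a *\<^sub>C y"
    and scaleC_add_left: "(a + b) *\<^sub>C x = a *\<^sub>C x + b *\<^sub>C x"
    and scaleC_scaleC: "a *\<^sub>C (b *\<^sub>C x) = (a * b) *\<^sub>C x"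
    and scaleC_one: "1 *\<^sub>C x = x"
    and scaleR_scaleC: "r *\<^sub>R x = complex_of_real r *\<^sub>C x"

class complex_inner = complex_vector + real_inner +
  fixes cinner :: "'a \<Rightarrow> 'a \<Rightarrow> complex"
  assumes cinner_commute: "cinner x y = cnj (cinner y x)"
    and cinner_add_left: "cinner (x + y) z = cinner x z + cinner y z"
    and cinner_scaleC_left: "cinner (a *\<^sub>C x) y = a * cinner x y"
    and inner_eq_Re_cinner: "inner x y = Re (cinner x y)"

class complex_hilbert_space = complex_inner + complete_space

instantiation complex :: complex_hilbert_space
begin

definition scaleC_complex :: "complex \<Rightarrow> complex \<Rightarrow> complex"
  where "scaleC_complex a x = a * x"

definition cinner_complex :: "complex \<Rightarrow> complex \<Rightarrow> complex"
  where "cinner_complex x y = x * cnj y"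

instance
  by standard
    (simp_all add: scaleC_complex_def cinner_complex_def inner_complex_def algebra_simps
      scaleR_conv_of_real)

end

definition bounded_clinear :: "('a::complex_inner \<Rightarrow> 'b::complex_inner) \<Rightarrow> bool"
  where "bounded_clinear T \<longleftrightarrow> bounded_linear T \<and> (\<forall>a x. T (a *\<^sub>C x) = a *\<^sub>C T x)"

text \<open>
  On a Hilbert space the description below denotes a unique operator whenever \<open>T\<close> is
  \<open>bounded_clinear\<close>, by the Riesz representation theorem.
\<close>

definition cadjoint :: "('a::complex_inner \<Rightarrow> 'b::complex_inner) \<Rightarrow> 'b \<Rightarrow> 'a"
  where "cadjoint T = (THE S. \<forall>x y. cinner (T x) y = cinner x (S y))"

text \<open>
  For a bounded operator on a nonzero space this is the supremum of a nonempty bounded set of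
  reals; on the zero space there are no unit vectors and the value is unspecified.
\<close>

definition numerical_radius :: "('a::complex_inner \<Rightarrow> 'a) \<Rightarrow> real"
  where "numerical_radius T = (SUP x\<in>{x. norm x = 1}. cmod (cinner (T x) x))"

end

theory Submission
  imports Defs
begin

text \<open>
  Write \<open>w\<close> for the numerical radius of \<open>A\<close> and \<open>M = A\<^sup>* A + A A\<^sup>*\<close>. Taking \<open>c = 0\<close> shows that
  the right-hand side of either equivalence implies the left-hand side. Since
  \<open>\<parallel>A\<parallel> \<le> sqrt \<parallel>M\<parallel> \<le> 2 w\<close> always holds (\<open>onorm_le_sqrt_onorm_anticomm\<close>,
  \<open>half_sqrt_onorm_anticomm_le\<close>), the hypothesis \<open>w = \<parallel>A\<parallel> / 2\<close> forces \<open>w = sqrt \<parallel>M\<parallel> / 2\<close>, so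
  it remains to treat the second equivalence from left to right.

  The upper bound \<open>w(A + c I) \<le> w + |c|\<close> is the triangle inequality. For the lower bound it
  suffices that the numerical range of \<open>A\<close> comes arbitrarily close to \<open>w\<close> in every direction:
  for each unimodular \<open>a\<close> the supremum of \<open>Re (a \<langle>A x, x\<rangle>)\<close> over unit vectors is \<open>w\<close>
  (\<open>numerical_radius_shift_eq\<close>). This form belongs to the symmetric operator
  \<open>H\<^sub>a = (a A + cnj a A\<^sup>*) / 2\<close>, whose norm is at most \<open>w\<close>.

  The key is the identity \<open>M = 2 (H\<^sub>a\<^sup>2 + H\<^sub>b\<^sup>2)\<close> with \<open>b = \<i> a\<close>, valid for every unimodular \<open>a\<close>
  (\<open>anticomm_eq_squares\<close>). If \<open>\<parallel>M\<parallel> = 4 w\<^sup>2\<close>, then a single sequence of unit vectors \<open>x\<^sub>n\<close> with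
  \<open>\<parallel>M x\<^sub>n\<parallel> \<rightarrow> 4 w\<^sup>2\<close> satisfies \<open>\<parallel>H\<^sub>a x\<^sub>n\<parallel> \<rightarrow> w\<close> for all \<open>a\<close> at once. Suppose that the form of some
  \<open>H\<^sub>a\<close> stays below \<open>h < w\<close>. Then \<open>w - H\<^sub>a\<close> is bounded below, and
  \<open>(w - H\<^sub>a)(w + H\<^sub>a) x\<^sub>n \<rightarrow> 0\<close> gives \<open>H\<^sub>a x\<^sub>n + w x\<^sub>n \<rightarrow> 0\<close>, hence \<open>Re (a \<langle>A x\<^sub>n, x\<^sub>n\<rangle>) \<rightarrow> - w\<close>
  (\<open>symmetric_form_tendsto_lower_end\<close>). A slightly rotated \<open>b\<close> has the same property, so also
  \<open>Re (b \<langle>A x\<^sub>n, x\<^sub>n\<rangle>) \<rightarrow> - w\<close>. Adding the two limits yields \<open>2 w \<le> |a + b| w\<close>, which contradicts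
  \<open>|a + b| < 2\<close> (\<open>extremal_reaches_every_direction\<close>).
\<close>

section \<open>Complex inner products\<close>

lemma cinner_add_right: "cinner x (y + z) = cinner x y + cinner x z"
  by (metis cinner_add_left cinner_commute complex_cnj_add)

lemma cinner_scaleC_right: "cinner x (a *\<^sub>C y) = cnj a * cinner x y"
  by (metis cinner_commute cinner_scaleC_left complex_cnj_mult)

lemma cinner_eqI:
  assumes "\<And>x. cinner x y = cinner x z"
  shows "y = z"
proof -
  have "\<forall>x. inner y x = inner z x"
    using assms by (metis inner_commute inner_eq_Re_cinner)
  then show ?thesis by (simp only: vector_eq_rdot)
qed

text \<open>
  The complex inner product is determined by its real part; through this identity every statement
  about \<open>cinner\<close> reduces to one about \<open>inner\<close>.
\<close>

lemma Im_cinner_eq_inner: "Im (cinner x y) = inner ((- \<i>) *\<^sub>C x) y"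
  by (simp add: inner_eq_Re_cinner cinner_scaleC_left)

lemma inner_scaleC_left: "inner (a *\<^sub>C x) y = inner x (cnj a *\<^sub>C (y :: 'a::complex_inner))"
  by (simp add: inner_eq_Re_cinner cinner_scaleC_left cinner_scaleC_right)

lemma norm_scaleC: "norm (a *\<^sub>C x) = cmod a * norm (x :: 'a::complex_inner)"
proof -
  have "inner (a *\<^sub>C x) (a *\<^sub>C x) = inner x ((cnj a * a) *\<^sub>C x)"
    by (simp add: inner_scaleC_left scaleC_scaleC)
  also have "(cnj a * a) *\<^sub>C x = (cmod a)\<^sup>2 *\<^sub>R x"
    by (metis complex_norm_square mult.commute scaleR_scaleC)
  finally have "(norm (a *\<^sub>C x))\<^sup>2 = (cmod a * norm x)\<^sup>2"
    by (simp add: power2_norm_eq_inner power_mult_distrib)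
  then show ?thesis
    by (simp add: power2_eq_iff_nonneg)
qed

lemma bounded_linear_scaleC: "bounded_linear (\<lambda>x :: 'a::complex_inner. a *\<^sub>C x)"
proof (rule bounded_linear_intro)
  show "a *\<^sub>C (r *\<^sub>R x) = r *\<^sub>R (a *\<^sub>C x)" for r and x :: 'a
    by (simp add: scaleR_scaleC scaleC_scaleC mult.commute)
  show "norm (a *\<^sub>C x) \<le> norm x * cmod a" for x :: 'a
    by (simp add: norm_scaleC)
qed (rule scaleC_add_right)

lemma cmod_as_rotated_Re:
  obtains a where "cmod a = 1" and "Re (a * z) = cmod z"
proof (cases "z = 0")
  case True
  then show ?thesis using that[of 1] by simp
next
  case False
  have "cnj (sgn z) * z = cmod z"
    using False by (simp add: sgn_eq complex_norm_square[symmetric] power2_eq_square mult.commute field_simps)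
  then show ?thesis
    using that[of "cnj (sgn z)"] False by (simp add: norm_sgn)
qed

text \<open>Rotating \<open>x\<close> makes the inner product a nonnegative real, where the real inequality applies.\<close>

lemma complex_Cauchy_Schwarz: "cmod (cinner x y) \<le> norm x * norm y"
proof -
  obtain a where a: "cmod a = 1" "Re (a * cinner x y) = cmod (cinner x y)"
    by (rule cmod_as_rotated_Re)
  have "Re (a * cinner x y) = inner (a *\<^sub>C x) y"
    by (simp add: inner_eq_Re_cinner cinner_scaleC_left)
  also have "\<dots> \<le> norm x * norm y"
    using norm_cauchy_schwarz[of "a *\<^sub>C x" y] a(1) by (simp add: norm_scaleC)
  finally show ?thesis using a(2) by simp
qed

section \<open>The adjoint operator\<close>

text \<open>
  The representing vector is the minimiser of \<open>J x = \<parallel>x\<parallel>\<^sup>2 - 2 f x\<close>. By the parallelogram law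
  minimising sequences are Cauchy, so completeness provides a minimiser \<open>u\<close>, and the vanishing of
  the derivative of \<open>J\<close> at \<open>u\<close> in the direction \<open>y\<close> says \<open>f y = \<langle>y, u\<rangle>\<close>.
\<close>

lemma riesz_representation:
  fixes f :: "'a::{real_inner,complete_space} \<Rightarrow> real"
  assumes f: "bounded_linear f"
  shows "\<exists>u. \<forall>x. f x = inner x u"
proof -
  interpret f: bounded_linear f by fact
  define J where "J x = (norm x)\<^sup>2 - 2 * f x" for x
  obtain K where K: "\<And>x. norm (f x) \<le> norm x * K"
    using f.bounded by blast
  have low: "J x \<ge> - K\<^sup>2" for x
  proof -
    have "0 \<le> (norm x - K)\<^sup>2" by simp
    then show ?thesis
      using K[of x] by (simp add: J_def power2_diff abs_le_iff)
  qed
  define m where "m = Inf (range J)"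
  have m_le: "m \<le> J x" for x
    unfolding m_def using low by (intro cInf_lower bdd_belowI2) auto
  have "\<exists>x. J x < m + 1 / Suc n" for n
  proof (rule ccontr)
    assume "\<not> ?thesis"
    then have "m + 1 / Suc n \<le> Inf (range J)"
      by (intro cInf_greatest) (auto simp: not_less)
    then show False by (simp add: m_def)
  qed
  then obtain X where X: "\<And>n. J (X n) < m + 1 / Suc n" by metis
  have close: "(norm (x - y))\<^sup>2 \<le> 2 * (J x - m) + 2 * (J y - m)" for x y
  proof -
    have "(norm (x - y))\<^sup>2 = 2 * J x + 2 * J y - 4 * J ((1/2) *\<^sub>R (x + y))"
      by (simp add: J_def power2_norm_eq_inner f.scaleR f.add algebra_simps inner_commute)
    then show ?thesis using m_le[of "(1/2) *\<^sub>R (x + y)"] by simp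
  qed
  have "Cauchy X"
  proof (rule metric_CauchyI)
    fix e :: real assume e: "e > 0"
    then obtain N where N: "1 / Suc N < e\<^sup>2 / 4"
      using nat_approx_posE[of "e\<^sup>2 / 4"] by auto
    have "dist (X i) (X j) < e" if "i \<ge> N" "j \<ge> N" for i j
    proof -
      have *: "J (X k) - m < e\<^sup>2 / 4" if "k \<ge> N" for k
      proof -
        have "1 / real (Suc k) \<le> 1 / real (Suc N)"
          using that by (intro divide_left_mono) auto
        then show ?thesis using X[of k] N by linarith
      qed
      have "(norm (X i - X j))\<^sup>2 < e\<^sup>2"
        using close[of "X i" "X j"] *[OF that(1)] *[OF that(2)] by simp
      then show ?thesis
        using e by (simp add: dist_norm power2_less_imp_less)
    qed
    then show "\<exists>N. \<forall>i\<ge>N. \<forall>j\<ge>N. dist (X i) (X j) < e" by blast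
  qed
  then obtain u where u: "X \<longlonglongrightarrow> u"
    using Cauchy_convergent convergentD by blast
  have "(\<lambda>n. J (X n)) \<longlonglongrightarrow> J u"
    unfolding J_def by (intro tendsto_intros f.tendsto u)
  moreover have "(\<lambda>n. m + 1 / Suc n) \<longlonglongrightarrow> m + 0"
    by (intro tendsto_intros LIMSEQ_Suc[OF lim_1_over_n])
  ultimately have "J u \<le> m + 0"
    using X by (intro LIMSEQ_le[where X = "\<lambda>n. J (X n)"]) (auto intro!: less_imp_le)
  then have min: "J u \<le> J x" for x using m_le[of x] by simp
  have "f y = inner y u" for y
  proof -
    \<comment> \<open>The derivative of \<open>J\<close> at \<open>u\<close> along \<open>y\<close> is \<open>2 d\<close>. A step of size \<open>- d / q\<close> would decrease \<open>J\<close>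
      if \<open>d\<close> were nonzero; the summand 1 in \<open>q\<close> covers \<open>y = 0\<close>.\<close>
    define d q where "d = inner y u - f y" and "q = (norm y)\<^sup>2 + 1"
    have q: "q > 0" by (simp add: q_def add_nonneg_pos)
    have "J (u + t *\<^sub>R y) = J u + 2 * t * d + t\<^sup>2 * (norm y)\<^sup>2" for t
      by (simp add: J_def d_def power2_norm_eq_inner f.scaleR f.add algebra_simps inner_commute,
          simp add: power2_eq_square algebra_simps)
    from min[of "u + (- d / q) *\<^sub>R y", unfolded this]
    have "0 \<le> q\<^sup>2 * (2 * (- d / q) * d + (- d / q)\<^sup>2 * (norm y)\<^sup>2)"
      by (intro mult_nonneg_nonneg) auto
    also have "\<dots> = - (d\<^sup>2 * (q + 1))"
      using q by (simp add: power2_eq_square field_simps) (simp add: q_def power2_eq_square algebra_simps)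
    finally have "d\<^sup>2 * (q + 1) \<le> 0" by simp
    then have "d = 0" using q by (simp add: mult_le_0_iff)
    then show ?thesis by (simp add: d_def)
  qed
  then show ?thesis by blast
qed

text \<open>
  Representing the real functional \<open>x \<mapsto> Re \<langle>T x, y\<rangle>\<close> gives a candidate \<open>S y\<close>; complex linearity
  of \<open>T\<close> extends the identity to imaginary parts, and nondegeneracy makes \<open>S\<close> the only operator
  that satisfies it, so that the definite description in \<open>cadjoint\<close> denotes \<open>S\<close>.
\<close>

lemma cinner_cadjoint:
  fixes T :: "'a::complex_hilbert_space \<Rightarrow> 'b::complex_inner"
  assumes T: "bounded_clinear T"
  shows "cinner (T x) y = cinner x (cadjoint T y)"
proof -
  interpret T: bounded_linear T using T by (simp add: bounded_clinear_def)
  have TC: "T (a *\<^sub>C x) = a *\<^sub>C T x" for a x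
    using T by (simp add: bounded_clinear_def)
  have "\<exists>u. \<forall>x. inner (T x) y = inner x u" for y
    by (rule riesz_representation) (rule bounded_linear_compose[OF bounded_linear_inner_left T.bounded_linear_axioms])
  then obtain S where S: "\<And>x y. inner (T x) y = inner x (S y)" by metis
  have ex: "\<forall>x y. cinner (T x) y = cinner x (S y)"
    by (intro allI complex_eqI)
      (simp_all add: Im_cinner_eq_inner S flip: inner_eq_Re_cinner TC)
  have "cadjoint T = S"
    unfolding cadjoint_def
  proof (rule the_equality)
    fix S' assume S': "\<forall>x y. cinner (T x) y = cinner x (S' y)"
    show "S' = S"
    proof
      show "S' y = S y" for y
        by (rule cinner_eqI) (rule trans[OF S'[rule_format, symmetric] ex[rule_format]])
    qed
  qed (fact ex)
  then show ?thesis using ex by simp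
qed

lemma inner_cadjoint:
  fixes T :: "'a::complex_hilbert_space \<Rightarrow> 'b::complex_inner"
  assumes "bounded_clinear T"
  shows "inner (T x) y = inner x (cadjoint T y)"
  using cinner_cadjoint[OF assms] by (simp add: inner_eq_Re_cinner)

lemma bounded_clinear_cadjoint:
  fixes T :: "'a::complex_hilbert_space \<Rightarrow> 'b::complex_inner"
  assumes T: "bounded_clinear T"
  shows "bounded_clinear (cadjoint T)"
proof -
  let ?S = "cadjoint T"
  note adj = cinner_cadjoint[OF T]
  interpret T: bounded_linear T using T by (simp add: bounded_clinear_def)
  have add: "?S (x + y) = ?S x + ?S y" for x y
    by (rule cinner_eqI) (simp add: cinner_add_right flip: adj)
  have scale: "?S (a *\<^sub>C x) = a *\<^sub>C ?S x" for a x
    by (rule cinner_eqI) (simp add: cinner_scaleC_right flip: adj)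
  have "norm (?S y) \<le> norm y * onorm T" for y
  proof (cases "?S y = 0")
    case True
    then show ?thesis by (simp add: onorm_pos_le T.bounded_linear_axioms)
  next
    case False
    have "norm (?S y) * norm (?S y) = inner (T (?S y)) y"
      by (simp add: inner_cadjoint[OF T] dot_square_norm power2_eq_square)
    also have "\<dots> \<le> norm (T (?S y)) * norm y" by (rule norm_cauchy_schwarz)
    also have "\<dots> \<le> (onorm T * norm (?S y)) * norm y"
      by (intro mult_right_mono onorm T.bounded_linear_axioms) auto
    finally show ?thesis using False by (simp add: mult_ac)
  qed
  then have "bounded_linear ?S"
    by (intro bounded_linear_intro[where K = "onorm T"] add) (simp_all add: scaleR_scaleC scale)
  then show ?thesis by (simp add: bounded_clinear_def scale)
qed

section \<open>The numerical radius\<close>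

lemma bdd_above_numerical_range:
  fixes T :: "'a::complex_inner \<Rightarrow> 'a"
  assumes "bounded_linear T"
  shows "bdd_above ((\<lambda>x. cmod (cinner (T x) x)) ` {x. norm x = 1})"
proof (rule bdd_aboveI2)
  fix x :: 'a assume "x \<in> {x. norm x = 1}"
  then show "cmod (cinner (T x) x) \<le> onorm T"
    using complex_Cauchy_Schwarz[of "T x" x] onorm[OF assms, of x] by simp
qed

lemma cmod_cinner_le_numerical_radius:
  assumes T: "bounded_linear T"
  shows "cmod (cinner (T x) x) \<le> numerical_radius T * (norm x)\<^sup>2"
proof (cases "x = 0")
  case True
  then show ?thesis
    using complex_Cauchy_Schwarz[of "T x" x] by simp
next
  case False
  interpret T: bounded_linear T by fact
  let ?u = "(1 / norm x) *\<^sub>R x"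
  have "cmod (cinner (T ?u) ?u) \<le> numerical_radius T"
    unfolding numerical_radius_def
    using False by (intro cSUP_upper bdd_above_numerical_range T) simp
  moreover have "cinner (T ?u) ?u = of_real (1 / (norm x)\<^sup>2) * cinner (T x) x"
    by (simp add: T.scaleR, simp add: scaleR_scaleC cinner_scaleC_left cinner_scaleC_right power2_eq_square)
  ultimately show ?thesis
    using False by (simp add: norm_mult norm_divide norm_power field_simps)
qed

lemma numerical_radius_least:
  fixes T :: "'a::complex_inner \<Rightarrow> 'a"
  assumes "(UNIV :: 'a set) \<noteq> {0}" and "\<And>x. norm x = 1 \<Longrightarrow> cmod (cinner (T x) x) \<le> b"
  shows "numerical_radius T \<le> b"
  unfolding numerical_radius_def
proof (rule cSUP_least)
  obtain x :: 'a where "x \<noteq> 0" using assms(1) by blast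
  then have "norm ((1 / norm x) *\<^sub>R x) = 1" by simp
  then show "{x :: 'a. norm x = 1} \<noteq> {}" by blast
qed (use assms(2) in simp)

lemma numerical_radius_nonneg:
  fixes T :: "'a::complex_inner \<Rightarrow> 'a"
  assumes "(UNIV :: 'a set) \<noteq> {0}" and "bounded_linear T"
  shows "0 \<le> numerical_radius T"
proof -
  obtain x :: 'a where x: "x \<noteq> 0" using assms(1) by blast
  have "0 \<le> numerical_radius T * (norm x)\<^sup>2"
    using cmod_cinner_le_numerical_radius[OF assms(2), of x] norm_ge_zero order_trans by blast
  then show ?thesis using x by (simp add: zero_le_mult_iff)
qed

lemma bounded_linear_add_scaleC:
  fixes T :: "'a::complex_inner \<Rightarrow> 'a"
  assumes "bounded_linear T"
  shows "bounded_linear (\<lambda>x. T x + c *\<^sub>C x)"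
  by (intro bounded_linear_add assms bounded_linear_scaleC)

lemma cinner_shift_unit:
  assumes "norm x = 1"
  shows "cinner (T x + c *\<^sub>C x) x = cinner (T x) x + c"
proof -
  have "cinner x x = 1"
    using assms by (intro complex_eqI)
      (simp_all add: Im_cinner_eq_inner norm_eq_1 flip: inner_eq_Re_cinner,
       metis cinner_commute cnj.sel(2) Im_cinner_eq_inner equal_neg_zero)
  then show ?thesis by (simp add: cinner_add_left cinner_scaleC_left)
qed

lemma numerical_radius_shift_le:
  fixes T :: "'a::complex_inner \<Rightarrow> 'a"
  assumes ne: "(UNIV :: 'a set) \<noteq> {0}" and T: "bounded_linear T"
  shows "numerical_radius (\<lambda>x. T x + c *\<^sub>C x) \<le> numerical_radius T + cmod c"
proof (rule numerical_radius_least[OF ne])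
  fix x :: 'a assume x: "norm x = 1"
  then show "cmod (cinner (T x + c *\<^sub>C x) x) \<le> numerical_radius T + cmod c"
    using cmod_cinner_le_numerical_radius[OF T, of x]
      norm_triangle_ineq[of "cinner (T x) x" c] by (simp add: cinner_shift_unit)
qed

text \<open>
  Choose the direction \<open>a\<close> that turns \<open>c\<close> into a positive number: unit vectors whose form value is
  almost \<open>w(T)\<close> in that direction add up with \<open>c\<close> without cancellation.
\<close>

lemma numerical_radius_shift_eq:
  fixes T :: "'a::complex_inner \<Rightarrow> 'a"
  assumes ne: "(UNIV :: 'a set) \<noteq> {0}" and T: "bounded_linear T"
    and reach: "\<And>a h. cmod a = 1 \<Longrightarrow> h < numerical_radius T \<Longrightarrow>
                  \<exists>x. norm x = 1 \<and> h < Re (a * cinner (T x) x)"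
  shows "numerical_radius (\<lambda>x. T x + c *\<^sub>C x) = numerical_radius T + cmod c"
proof (rule antisym[OF numerical_radius_shift_le[OF ne T]])
  obtain a where a: "cmod a = 1" "Re (a * c) = cmod c" by (rule cmod_as_rotated_Re)
  show "numerical_radius T + cmod c \<le> numerical_radius (\<lambda>x. T x + c *\<^sub>C x)"
  proof (rule dense_le)
    fix h assume "h < numerical_radius T + cmod c"
    then obtain x where x: "norm x = 1" "h - cmod c < Re (a * cinner (T x) x)"
      using reach[OF a(1), of "h - cmod c"] by auto
    have "h \<le> Re (a * (cinner (T x) x + c))"
      using x(2) a(2) by (simp add: algebra_simps)
    also have "\<dots> \<le> cmod (cinner (T x) x + c)"
      using complex_Re_le_cmod[of "a * (cinner (T x) x + c)"] a(1) by (simp add: norm_mult)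
    also have "\<dots> \<le> numerical_radius (\<lambda>x. T x + c *\<^sub>C x)"
      using cmod_cinner_le_numerical_radius[OF bounded_linear_add_scaleC[OF T], of x c] x(1)
      by (simp add: cinner_shift_unit)
    finally show "h \<le> numerical_radius (\<lambda>x. T x + c *\<^sub>C x)" .
  qed
qed

lemma maximising_sequence:
  fixes M :: "'b::real_normed_vector \<Rightarrow> 'c::real_normed_vector"
  assumes M: "bounded_linear M" and pos: "0 < onorm M"
  obtains X where "\<And>n. norm (X n) = 1" and "(\<lambda>n. norm (M (X n))) \<longlonglongrightarrow> onorm M"
proof -
  interpret M: bounded_linear M by fact
  have "\<exists>x. norm x = 1 \<and> onorm M - 1 / Suc n < norm (M x)" for n
  proof (rule ccontr)
    assume neg: "\<not> ?thesis"
    \<comment> \<open>The maximum with 0 keeps the bound nonnegative, also when the tolerance exceeds the norm.\<close>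
    define b where "b = max 0 (onorm M - 1 / Suc n)"
    have "norm (M x) \<le> b * norm x" for x
    proof (cases "x = 0")
      case False
      have "norm ((1 / norm x) *\<^sub>R x) = 1" using False by simp
      with neg have "norm (M ((1 / norm x) *\<^sub>R x)) \<le> b" unfolding b_def by fastforce
      then show ?thesis using False by (simp add: M.scaleR field_simps)
    qed (simp add: M.zero)
    then have "onorm M \<le> b" by (intro onorm_bound) (auto simp: b_def)
    then show False using pos by (auto simp: b_def max_def split: if_splits)
  qed
  then obtain X where X: "\<And>n. norm (X n) = 1" "\<And>n. onorm M - 1 / Suc n < norm (M (X n))"
    by metis
  have "(\<lambda>n. onorm M - 1 / Suc n) \<longlonglongrightarrow> onorm M - 0"
    by (intro tendsto_intros LIMSEQ_Suc[OF lim_1_over_n])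
  then have lower: "(\<lambda>n. onorm M - 1 / Suc n) \<longlonglongrightarrow> onorm M" by simp
  have "(\<lambda>n. norm (M (X n))) \<longlonglongrightarrow> onorm M"
  proof (rule tendsto_sandwich[OF _ _ lower tendsto_const])
    show "\<forall>\<^sub>F n in sequentially. onorm M - 1 / Suc n \<le> norm (M (X n))"
      by (intro always_eventually allI less_imp_le X(2))
    show "\<forall>\<^sub>F n in sequentially. norm (M (X n)) \<le> onorm M"
      using onorm[OF M, of "X _"] X(1) by (simp add: always_eventually)
  qed
  then show ?thesis using that X(1) by blast
qed

section \<open>Symmetric operators and their quadratic forms\<close>

text \<open>
  Polarisation expresses \<open>4 \<langle>H x, y\<rangle>\<close> by the form at \<open>x + y\<close> and \<open>x - y\<close>, and the parallelogram law
  bounds the result when \<open>y\<close> is the multiple of \<open>H x\<close> that has the length of \<open>x\<close>.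
\<close>

lemma symmetric_norm_le:
  fixes H :: "'a::real_inner \<Rightarrow> 'a"
  assumes H: "linear H" and sym: "\<And>x y. inner (H x) y = inner x (H y)"
    and form: "\<And>x. \<bar>inner (H x) x\<bar> \<le> w * (norm x)\<^sup>2"
  shows "norm (H x) \<le> w * norm x"
proof (cases "H x = 0")
  case True
  show ?thesis
  proof (cases "x = 0")
    case False
    have "0 \<le> w * (norm x)\<^sup>2" using form[of x] by linarith
    then show ?thesis using True False by (simp add: zero_le_mult_iff)
  qed (simp add: linear_0[OF H])
next
  case False
  then have x: "x \<noteq> 0" using H linear_0 by blast
  define y where "y = (norm x / norm (H x)) *\<^sub>R H x"
  have ny: "norm y = norm x" using False by (simp add: y_def)
  have "4 * inner (H x) y = inner (H (x + y)) (x + y) - inner (H (x - y)) (x - y)"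
    using sym[of x y] by (simp add: linear_add[OF H] linear_diff[OF H] inner_simps inner_commute)
  also have "\<dots> \<le> w * (norm (x + y))\<^sup>2 + w * (norm (x - y))\<^sup>2"
    using form[of "x + y"] form[of "x - y"] by linarith
  also have "\<dots> = w * (2 * (norm x)\<^sup>2 + 2 * (norm y)\<^sup>2)"
    by (simp add: power2_norm_eq_inner inner_simps inner_commute algebra_simps)
  finally have "inner (H x) y \<le> w * (norm x)\<^sup>2" by (simp add: ny)
  also have "inner (H x) y = norm x * norm (H x)"
    using False by (simp add: y_def dot_square_norm power2_eq_square)
  finally show ?thesis using x by (simp add: power2_eq_square)
qed

text \<open>
  A quantitative spectral statement: if the form of \<open>H\<close> stays below \<open>h < w\<close>, then a unit vector whose
  image has almost the maximal length \<open>w\<close> is almost an eigenvector for \<open>- w\<close>. With \<open>y = (H + w) x\<close> the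
  vector \<open>r = (w - H) y = (w\<^sup>2 - H\<^sup>2) x\<close> is short because \<open>\<parallel>H x\<parallel>\<close> is near \<open>w\<close>, while
  \<open>(w - h) \<parallel>y\<parallel>\<^sup>2 \<le> \<langle>r, y\<rangle>\<close> bounds \<open>y\<close> by \<open>r\<close>.
\<close>

lemma symmetric_lower_end:
  fixes H :: "'a::real_inner \<Rightarrow> 'a"
  assumes H: "linear H" and sym: "\<And>x y. inner (H x) y = inner x (H y)"
    and bound: "\<And>x. norm (H x) \<le> w * norm x" and w: "0 \<le> w"
    and h: "h < w" "\<And>x. inner (H x) x \<le> h * (norm x)\<^sup>2" and x: "norm x = 1"
  shows "((w - h) * norm (H x + w *\<^sub>R x))\<^sup>2 \<le> w\<^sup>2 * (w\<^sup>2 - (norm (H x))\<^sup>2)"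
proof -
  define y where "y = H x + w *\<^sub>R x"
  define r where "r = w\<^sup>2 *\<^sub>R x - H (H x)"
  have r: "r = w *\<^sub>R y - H y"
    by (simp add: r_def y_def linear_add[OF H] linear_cmul[OF H] algebra_simps power2_eq_square)
  have "(w - h) * norm y * norm y = w * (norm y)\<^sup>2 - h * (norm y)\<^sup>2"
    by (simp add: power2_eq_square algebra_simps)
  also have "\<dots> \<le> inner r y"
    using h(2)[of y] by (simp add: r inner_diff_left dot_square_norm)
  also have "\<dots> \<le> norm r * norm y" by (rule norm_cauchy_schwarz)
  finally have "(w - h) * norm y \<le> norm r"
    by (cases "y = 0") auto
  then have "((w - h) * norm y)\<^sup>2 \<le> (norm r)\<^sup>2"
    using h(1) by (intro power_mono) auto
  also have "(norm r)\<^sup>2 = w\<^sup>2 * w\<^sup>2 - 2 * w\<^sup>2 * (norm (H x))\<^sup>2 + (norm (H (H x)))\<^sup>2"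
  proof -
    have "inner x x = 1" using x by (simp add: norm_eq_1)
    then show ?thesis
      by (simp add: r_def power2_norm_eq_inner inner_diff_left inner_diff_right sym[of "H x" x]
          inner_commute sym[of x "H x", symmetric] algebra_simps)
  qed
  also have "\<dots> \<le> w\<^sup>2 * w\<^sup>2 - 2 * w\<^sup>2 * (norm (H x))\<^sup>2 + (w * norm (H x))\<^sup>2"
    using bound[of "H x"] by (simp add: power_mono)
  finally show ?thesis by (simp add: y_def power_mult_distrib algebra_simps)
qed

lemma symmetric_form_tendsto_lower_end:
  fixes H :: "'a::real_inner \<Rightarrow> 'a"
  assumes H: "linear H" and sym: "\<And>x y. inner (H x) y = inner x (H y)"
    and bound: "\<And>x. norm (H x) \<le> w * norm x" and w: "0 \<le> w"
    and h: "h < w" "\<And>x. inner (H x) x \<le> h * (norm x)\<^sup>2"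
    and X: "\<And>n. norm (X n) = 1" "(\<lambda>n. norm (H (X n))) \<longlonglongrightarrow> w"
  shows "(\<lambda>n. inner (H (X n)) (X n)) \<longlonglongrightarrow> - w"
proof -
  define Y where "Y n = H (X n) + w *\<^sub>R X n" for n
  have "(\<lambda>n. w\<^sup>2 * (w\<^sup>2 - (norm (H (X n)))\<^sup>2)) \<longlonglongrightarrow> w\<^sup>2 * (w\<^sup>2 - w\<^sup>2)"
    by (intro tendsto_intros X)
  then have lim: "(\<lambda>n. w\<^sup>2 * (w\<^sup>2 - (norm (H (X n)))\<^sup>2)) \<longlonglongrightarrow> 0" by simp
  have "(\<lambda>n. ((w - h) * norm (Y n))\<^sup>2) \<longlonglongrightarrow> 0"
    unfolding Y_def
    by (rule tendsto_sandwich[OF _ _ tendsto_const lim])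
      (auto intro!: always_eventually symmetric_lower_end[OF H sym bound w h X(1)])
  then have "(\<lambda>n. norm (Y n)) \<longlonglongrightarrow> 0"
    using h(1) by (auto simp: power_mult_distrib tendsto_mult_left_iff tendsto_null_power
        dest!: tendsto_real_sqrt simp flip: real_sqrt_mult)
  then have "(\<lambda>n. inner (Y n) (X n)) \<longlonglongrightarrow> 0"
  proof (rule Lim_null_comparison[rotated])
    show "\<forall>\<^sub>F n in sequentially. norm (inner (Y n) (X n)) \<le> norm (Y n)"
      using Cauchy_Schwarz_ineq2[of "Y _" "X _"] X(1) by (simp add: always_eventually)
  qed
  then have "(\<lambda>n. inner (Y n) (X n) - w) \<longlonglongrightarrow> 0 - w"
    by (intro tendsto_intros)
  moreover have "inner (Y n) (X n) - w = inner (H (X n)) (X n)" for n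
    using X(1)[of n] by (simp add: Y_def inner_add_left norm_eq_1)
  ultimately show ?thesis by simp
qed

section \<open>Real parts of the rotated operator\<close>

text \<open>The Hermitian part of \<open>a A\<close>; only unimodular \<open>a\<close>, that is rotations of \<open>A\<close>, matter below.\<close>

definition rotated_Re :: "('a::complex_inner \<Rightarrow> 'a) \<Rightarrow> complex \<Rightarrow> 'a \<Rightarrow> 'a"
  where "rotated_Re A a x = (1 / 2) *\<^sub>R (a *\<^sub>C A x + cnj a *\<^sub>C cadjoint A x)"

abbreviation adj_anticomm :: "('a::complex_inner \<Rightarrow> 'a) \<Rightarrow> 'a \<Rightarrow> 'a"
  where "adj_anticomm A \<equiv> \<lambda>x. cadjoint A (A x) + A (cadjoint A x)"

context
  fixes A :: "'a::complex_hilbert_space \<Rightarrow> 'a"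
  assumes A: "bounded_clinear A"
begin

lemma bounded_linear_operator: "bounded_linear A" and operator_scaleC: "A (a *\<^sub>C x) = a *\<^sub>C A x"
  using A by (auto simp: bounded_clinear_def)

lemma bounded_linear_adjoint: "bounded_linear (cadjoint A)"
  and adjoint_scaleC: "cadjoint A (a *\<^sub>C x) = a *\<^sub>C cadjoint A x"
  using bounded_clinear_cadjoint[OF A] by (auto simp: bounded_clinear_def)

lemma linear_rotated_Re: "linear (rotated_Re A a)"
  unfolding rotated_Re_def
  by (intro bounded_linear.linear bounded_linear_add
      bounded_linear_compose[OF bounded_linear_scaleR_right]
      bounded_linear_compose[OF bounded_linear_scaleC] bounded_linear_operator bounded_linear_adjoint)

lemma rotated_Re_symmetric: "inner (rotated_Re A a x) y = inner x (rotated_Re A a y)"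
proof -
  have "inner (a *\<^sub>C A x) y = inner x (cnj a *\<^sub>C cadjoint A y)" for x y and a
    by (simp add: inner_scaleC_left inner_cadjoint[OF A] adjoint_scaleC)
  from this[of a x y] this[of a y x] show ?thesis
    by (simp add: rotated_Re_def inner_add_left inner_add_right inner_commute)
qed

lemma rotated_Re_form: "inner (rotated_Re A a x) x = Re (a * cinner (A x) x)"
proof -
  have "inner (a *\<^sub>C A x) x = inner x (cnj a *\<^sub>C cadjoint A x)"
    by (simp add: inner_scaleC_left inner_cadjoint[OF A] adjoint_scaleC)
  moreover have "inner (a *\<^sub>C A x) x = Re (a * cinner (A x) x)"
    by (simp add: inner_eq_Re_cinner cinner_scaleC_left)
  ultimately show ?thesis
    by (simp add: rotated_Re_def inner_add_left inner_commute[of "cnj a *\<^sub>C cadjoint A x"])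
qed

lemma Re_cinner_le:
  assumes "cmod a = 1"
  shows "\<bar>Re (a * cinner (A x) x)\<bar> \<le> numerical_radius A * (norm x)\<^sup>2"
  using abs_Re_le_cmod[of "a * cinner (A x) x"] cmod_cinner_le_numerical_radius[OF bounded_linear_operator, of x] assms
  by (simp add: norm_mult)

lemma norm_rotated_Re_le:
  assumes "cmod a = 1"
  shows "norm (rotated_Re A a x) \<le> numerical_radius A * norm x"
  using linear_rotated_Re rotated_Re_symmetric
  by (rule symmetric_norm_le) (simp only: rotated_Re_form Re_cinner_le[OF assms])

text \<open>
  The operators for \<open>a\<close> and \<open>\<i> a\<close> are, up to sign, the real and imaginary parts of \<open>a A\<close>. In the
  sum of their squares the terms in \<open>A\<^sup>2\<close> and its adjoint cancel because \<open>(\<i> a)\<^sup>2 = - a\<^sup>2\<close>, which is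
  why the sum does not depend on \<open>a\<close>.
\<close>

lemma anticomm_eq_squares:
  assumes "cmod a = 1"
  shows "adj_anticomm A x = 2 *\<^sub>R (rotated_Re A a (rotated_Re A a x)
            + rotated_Re A (\<i> * a) (rotated_Re A (\<i> * a) x))"
proof -
  interpret A: bounded_linear A by (rule bounded_linear_operator)
  interpret S: bounded_linear "cadjoint A" by (rule bounded_linear_adjoint)
  have a: "a * cnj a = 1" using assms by (simp add: complex_norm_square[symmetric])
  have neg: "(- c) *\<^sub>C y = - (c *\<^sub>C y)" for c and y :: 'a
    by (metis add.right_inverse add_cancel_right_left eq_neg_iff_add_eq_0 scaleC_add_left)
  have square: "rotated_Re A b (rotated_Re A b x) = (1/4) *\<^sub>R ((b * b) *\<^sub>C A (A x) +
          (b * cnj b) *\<^sub>C adj_anticomm A x + (cnj b * cnj b) *\<^sub>C cadjoint A (cadjoint A x))" for b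
    by (simp add: rotated_Re_def A.add A.scaleR S.add S.scaleR operator_scaleC adjoint_scaleC scaleC_add_right
        scaleC_scaleC scaleR_scaleC mult_ac add_ac)
  define U V where "U = (a * a) *\<^sub>C A (A x)" and "V = (cnj a * cnj a) *\<^sub>C cadjoint A (cadjoint A x)"
  have "rotated_Re A a (rotated_Re A a x) = (1/4) *\<^sub>R (U + adj_anticomm A x + V)"
    by (simp only: square a scaleC_one U_def V_def)
  moreover have "rotated_Re A (\<i> * a) (rotated_Re A (\<i> * a) x) = (1/4) *\<^sub>R (- U + adj_anticomm A x + - V)"
  proof -
    have "(\<i> * a) * (\<i> * a) = - (a * a)" "(\<i> * a) * cnj (\<i> * a) = 1"
      "cnj (\<i> * a) * cnj (\<i> * a) = - (cnj a * cnj a)"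
      using a by (simp_all add: algebra_simps)
    then show ?thesis by (simp only: square neg scaleC_one U_def V_def)
  qed
  ultimately have "2 *\<^sub>R (rotated_Re A a (rotated_Re A a x)
            + rotated_Re A (\<i> * a) (rotated_Re A (\<i> * a) x))
      = (1/2) *\<^sub>R (adj_anticomm A x + adj_anticomm A x)"
    by (simp flip: scaleR_add_right)
  then show ?thesis by (simp flip: scaleR_2)
qed

text \<open>
  Only one factor of each square is estimated by the numerical radius; keeping the other factor shows,
  when the anticommutator has the norm \<open>4 w\<^sup>2\<close>, that unit vectors almost attaining this norm almost
  attain the bound \<open>w\<close> in both terms on the right.
\<close>

lemma norm_anticomm_le:
  assumes a: "cmod a = 1"
  shows "norm (adj_anticomm A x)
    \<le> 2 * numerical_radius A * (norm (rotated_Re A a x) + norm (rotated_Re A (\<i> * a) x))"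
proof -
  have ia: "cmod (\<i> * a) = 1" using a by (simp add: norm_mult)
  have "norm (adj_anticomm A x) = 2 * norm (rotated_Re A a (rotated_Re A a x)
            + rotated_Re A (\<i> * a) (rotated_Re A (\<i> * a) x))"
    unfolding anticomm_eq_squares[OF a] by simp
  also have "\<dots> \<le> 2 * (norm (rotated_Re A a (rotated_Re A a x))
            + norm (rotated_Re A (\<i> * a) (rotated_Re A (\<i> * a) x)))"
    by (intro mult_left_mono norm_triangle_ineq) simp
  also have "\<dots> \<le> 2 * (numerical_radius A * norm (rotated_Re A a x)
            + numerical_radius A * norm (rotated_Re A (\<i> * a) x))"
    by (intro mult_left_mono add_mono norm_rotated_Re_le a ia) simp
  finally show ?thesis
    by (simp add: algebra_simps)
qed

section \<open>The norm of the anticommutator of an operator and its adjoint\<close>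

lemma bounded_linear_anticomm: "bounded_linear (adj_anticomm A)"
  by (intro bounded_linear_add bounded_linear_compose[OF bounded_linear_operator] bounded_linear_compose[OF bounded_linear_adjoint] bounded_linear_operator bounded_linear_adjoint)

lemma half_sqrt_onorm_anticomm_le:
  assumes nonzero: "(UNIV :: 'a set) \<noteq> {0}"
  shows "1 / 2 * sqrt (onorm (adj_anticomm A)) \<le> numerical_radius A"
proof -
  let ?w = "numerical_radius A"
  have w: "0 \<le> ?w" by (rule numerical_radius_nonneg[OF nonzero bounded_linear_operator])
  have "onorm (adj_anticomm A) \<le> (2 * ?w)\<^sup>2"
  proof (rule onorm_bound)
    fix x
    have "norm (adj_anticomm A x) \<le> 2 * ?w * (norm (rotated_Re A 1 x) + norm (rotated_Re A (\<i> * 1) x))"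
      by (rule norm_anticomm_le) simp
    also have "\<dots> \<le> 2 * ?w * (?w * norm x + ?w * norm x)"
      using w by (intro mult_left_mono add_mono norm_rotated_Re_le) auto
    finally show "norm (adj_anticomm A x) \<le> (2 * ?w)\<^sup>2 * norm x"
      by (simp add: power2_eq_square algebra_simps)
  qed simp
  then have "sqrt (onorm (adj_anticomm A)) \<le> 2 * ?w"
    using w by (intro real_le_lsqrt onorm_pos_le bounded_linear_anticomm) auto
  then show ?thesis by simp
qed

text \<open>The form of the anticommutator is \<open>\<parallel>A x\<parallel>\<^sup>2 + \<parallel>A\<^sup>* x\<parallel>\<^sup>2\<close>, which dominates \<open>\<parallel>A x\<parallel>\<^sup>2\<close>.\<close>

lemma onorm_le_sqrt_onorm_anticomm: "onorm A \<le> sqrt (onorm (adj_anticomm A))"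
proof (rule onorm_bound)
  fix x
  let ?s = "onorm (adj_anticomm A)"
  have "inner (adj_anticomm A x) x = (norm (A x))\<^sup>2 + (norm (cadjoint A x))\<^sup>2"
    using inner_cadjoint[OF A, of x "A x"] inner_cadjoint[OF A, of "cadjoint A x" x]
    by (simp add: inner_add_left inner_add_right dot_square_norm inner_commute)
  then have "(norm (A x))\<^sup>2 \<le> inner (adj_anticomm A x) x" by simp
  also have "\<dots> \<le> norm (adj_anticomm A x) * norm x" by (rule norm_cauchy_schwarz)
  also have "\<dots> \<le> (?s * norm x) * norm x"
    by (intro mult_right_mono onorm bounded_linear_anticomm) auto
  also have "\<dots> = (sqrt ?s * norm x)\<^sup>2"
    by (simp add: power_mult_distrib onorm_pos_le bounded_linear_anticomm)
      (simp add: power2_eq_square)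
  finally have "(norm (A x))\<^sup>2 \<le> (sqrt ?s * norm x)\<^sup>2" .
  then show "norm (A x) \<le> sqrt ?s * norm x"
    by (rule power2_le_imp_le) (simp add: onorm_pos_le bounded_linear_anticomm)
qed (simp add: onorm_pos_le bounded_linear_anticomm)

section \<open>Operators with extremal numerical radius\<close>

text \<open>
  The maximising sequence does not depend on the direction, so a bound \<open>h < w\<close> on the form in a
  direction \<open>a\<close> drives the form values \<open>\<langle>A x\<^sub>n, x\<^sub>n\<rangle>\<close> to the single point \<open>- w / a\<close>. Such a bound
  persists in neighbouring directions \<open>b\<close>, where it would drive them to the different point \<open>- w / b\<close>.
\<close>

lemma extremal_reaches_every_direction:
  assumes nonzero: "(UNIV :: 'a set) \<noteq> {0}"
    and extremal: "numerical_radius A = 1 / 2 * sqrt (onorm (adj_anticomm A))"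
    and a: "cmod a = 1" and h: "h < numerical_radius A"
  shows "\<exists>x. norm x = 1 \<and> h < Re (a * cinner (A x) x)"
proof (rule ccontr)
  let ?w = "numerical_radius A"
  assume "\<not> ?thesis"
  then have unit_le: "Re (a * cinner (A x) x) \<le> h" if "norm x = 1" for x
    using that by fastforce
  obtain v :: 'a where "v \<noteq> 0" using nonzero by blast
  then have v: "norm ((1 / norm v) *\<^sub>R v) = 1" by simp
  have w0: "0 \<le> ?w" by (rule numerical_radius_nonneg[OF nonzero bounded_linear_operator])
  have "- ?w \<le> h"
    using unit_le[OF v] Re_cinner_le[OF a, of "(1 / norm v) *\<^sub>R v"] v by simp
  \<comment> \<open>If \<open>w\<close> were zero, all form values would vanish, contrary to the upper bound \<open>h < 0\<close>.\<close>
  then have w: "0 < ?w" using h w0 by linarith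
  have s: "onorm (adj_anticomm A) = (2 * ?w)\<^sup>2"
    using extremal onorm_pos_le[OF bounded_linear_anticomm] by (simp add: field_simps)
  then obtain X where X: "\<And>n. norm (X n) = 1"
      "(\<lambda>n. norm (adj_anticomm A (X n))) \<longlonglongrightarrow> (2 * ?w)\<^sup>2"
    using maximising_sequence[OF bounded_linear_anticomm] w by auto
  have norm_lim: "(\<lambda>n. norm (rotated_Re A b (X n))) \<longlonglongrightarrow> ?w" if b: "cmod b = 1" for b
  proof (rule tendsto_sandwich[OF _ _ _ tendsto_const])
    have ib: "cmod (\<i> * b) = 1" using b by (simp add: norm_mult)
    show "\<forall>\<^sub>F n in sequentially. norm (rotated_Re A b (X n)) \<le> ?w"
      using norm_rotated_Re_le[OF b, of "X _"] X(1) by (simp add: always_eventually)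
    have "norm (adj_anticomm A (X n)) / (2 * ?w) - ?w \<le> norm (rotated_Re A b (X n))" for n
    proof -
      have "norm (adj_anticomm A (X n))
          \<le> 2 * ?w * (norm (rotated_Re A b (X n)) + norm (rotated_Re A (\<i> * b) (X n)))"
        by (rule norm_anticomm_le[OF b])
      also have "\<dots> \<le> 2 * ?w * (norm (rotated_Re A b (X n)) + ?w)"
        using norm_rotated_Re_le[OF ib, of "X n"] X(1)[of n] w by (intro mult_left_mono) auto
      finally have "norm (adj_anticomm A (X n)) / (2 * ?w) \<le> norm (rotated_Re A b (X n)) + ?w"
        using w by (simp add: divide_le_eq mult.commute)
      then show ?thesis by simp
    qed
    then show "\<forall>\<^sub>F n in sequentially.
        norm (adj_anticomm A (X n)) / (2 * ?w) - ?w \<le> norm (rotated_Re A b (X n))"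
      by (simp add: always_eventually)
    have "(\<lambda>n. norm (adj_anticomm A (X n)) / (2 * ?w) - ?w) \<longlonglongrightarrow> (2 * ?w)\<^sup>2 / (2 * ?w) - ?w"
      using w by (intro tendsto_intros X(2)) auto
    then show "(\<lambda>n. norm (adj_anticomm A (X n)) / (2 * ?w) - ?w) \<longlonglongrightarrow> ?w"
      using w by (simp add: power2_eq_square)
  qed
  have form_lim: "(\<lambda>n. Re (b * cinner (A (X n)) (X n))) \<longlonglongrightarrow> - ?w"
    if b: "cmod b = 1" and k: "k < ?w" "\<And>x. norm x = 1 \<Longrightarrow> Re (b * cinner (A x) x) \<le> k" for b k
  proof -
    have "inner (rotated_Re A b x) x \<le> k * (norm x)\<^sup>2" for x
    proof (cases "x = 0")
      case False
      interpret A: bounded_linear A by (rule bounded_linear_operator)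
      let ?u = "(1 / norm x) *\<^sub>R x"
      have "inner (rotated_Re A b ?u) ?u \<le> k"
        unfolding rotated_Re_form using False by (intro k(2)) simp
      then show ?thesis
        using False by (simp add: linear_cmul[OF linear_rotated_Re] field_simps power2_eq_square)
    qed simp
    from symmetric_form_tendsto_lower_end[OF linear_rotated_Re rotated_Re_symmetric
        norm_rotated_Re_le[OF b] w0 k(1) this X(1) norm_lim[OF b]]
    show ?thesis by (simp add: rotated_Re_form)
  qed
  \<comment> \<open>\<open>g t\<close> bounds the form in the direction \<open>cis t * a\<close>, and \<open>g 0 = h\<close>.\<close>
  define g where "g t = h + cmod (cis t * a - a) * ?w" for t
  have "g 0 < ?w" using h by (simp add: g_def)
  moreover have "(g \<longlongrightarrow> g 0) (at 0)"
    unfolding g_def by (intro tendsto_intros)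
  ultimately have "\<forall>\<^sub>F t in at 0. g t < ?w"
    by (rule order_tendstoD(2)[rotated])
  then obtain d where d: "d > 0" "\<And>t. t \<noteq> 0 \<Longrightarrow> \<bar>t\<bar> < d \<Longrightarrow> g t < ?w"
    by (auto simp: eventually_at dist_real_def)
  \<comment> \<open>The cap at 1 keeps \<open>t\<close> inside \<open>(0, pi)\<close>, where \<open>cos t < 1\<close>.\<close>
  define t where "t = min (d / 2) 1"
  have t: "0 < t" "t \<le> 1" "g t < ?w" using d by (auto simp: t_def)
  define b where "b = cis t * a"
  have b: "cmod b = 1" using a by (simp add: b_def norm_mult)
  have b_le: "Re (b * cinner (A x) x) \<le> g t" if x: "norm x = 1" for x
  proof -
    have "Re (b * cinner (A x) x) = Re (a * cinner (A x) x) + Re ((b - a) * cinner (A x) x)"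
      by (simp add: algebra_simps)
    also have "\<dots> \<le> h + cmod ((b - a) * cinner (A x) x)"
      by (intro add_mono unit_le x complex_Re_le_cmod)
    also have "\<dots> \<le> g t"
      using cmod_cinner_le_numerical_radius[OF bounded_linear_operator, of x] x
      by (simp add: g_def b_def norm_mult mult_left_mono)
    finally show ?thesis .
  qed
  have "(\<lambda>n. Re (a * cinner (A (X n)) (X n)) + Re (b * cinner (A (X n)) (X n))) \<longlonglongrightarrow> - ?w + - ?w"
    using form_lim[OF a h unit_le] form_lim[OF b t(3) b_le] by (intro tendsto_add)
  moreover have "- (cmod (a + b) * ?w) \<le> Re (a * cinner (A (X n)) (X n)) + Re (b * cinner (A (X n)) (X n))" for n
  proof -
    have "\<bar>Re ((a + b) * cinner (A (X n)) (X n))\<bar> \<le> cmod (a + b) * cmod (cinner (A (X n)) (X n))"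
      using abs_Re_le_cmod by (metis norm_mult)
    also have "\<dots> \<le> cmod (a + b) * ?w"
      using cmod_cinner_le_numerical_radius[OF bounded_linear_operator, of "X n"] X(1) by (simp add: mult_left_mono)
    finally show ?thesis by (simp add: algebra_simps abs_le_iff)
  qed
  ultimately have "- (cmod (a + b) * ?w) \<le> - ?w + - ?w"
    by (intro LIMSEQ_le_const) blast+
  then have "2 * ?w \<le> cmod (a + b) * ?w" by linarith
  then have "2 \<le> cmod (a + b)" using w by (simp only: mult_le_cancel_right_pos)
  moreover have "cmod (a + b) < 2"
  proof -
    have "a + b = a * (1 + cis t)" by (simp add: b_def algebra_simps)
    then have "(cmod (a + b))\<^sup>2 = (1 + cos t)\<^sup>2 + (sin t)\<^sup>2"
      using a by (simp add: norm_mult cmod_power2)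
    also have "\<dots> = 2 + 2 * cos t"
      using sin_cos_squared_add[of t] by (simp add: power2_sum)
    also have "\<dots> < 2\<^sup>2"
      using cos_monotone_0_pi[of 0 t] t pi_gt3 by simp
    finally show ?thesis by (rule power2_less_imp_less) simp
  qed
  ultimately show False by simp
qed

end

theorem theorem2p23:
  fixes A :: "'a::complex_hilbert_space \<Rightarrow> 'a"
  assumes nonzero: "(UNIV :: 'a set) \<noteq> {0}"
    and A: "bounded_clinear A"
  shows "(numerical_radius A = 1 / 2 * onorm A \<longleftrightarrow>
           (\<forall>c::complex. numerical_radius (\<lambda>x. A x + c *\<^sub>C x) = 1 / 2 * onorm A + cmod c))
       \<and> (numerical_radius A = 1 / 2 * sqrt (onorm (\<lambda>x. cadjoint A (A x) + A (cadjoint A x))) \<longleftrightarrow>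
           (\<forall>c::complex. numerical_radius (\<lambda>x. A x + c *\<^sub>C x) =
              1 / 2 * sqrt (onorm (\<lambda>x. cadjoint A (A x) + A (cadjoint A x))) + cmod c))"
proof -
  let ?s = "1 / 2 * sqrt (onorm (\<lambda>x. cadjoint A (A x) + A (cadjoint A x)))"
  have zero: "0 *\<^sub>C x = 0" for x :: 'a
    by (metis of_real_0 scaleR_scaleC scaleR_zero_left)
  have shift: "numerical_radius (\<lambda>x. A x + c *\<^sub>C x) = ?s + cmod c"
    if "numerical_radius A = ?s" for c
    using numerical_radius_shift_eq[OF nonzero bounded_linear_operator[OF A]
        extremal_reaches_every_direction[OF A nonzero that]] that by simp
  have at_0: "numerical_radius A = r"
    if "\<forall>c. numerical_radius (\<lambda>x. A x + c *\<^sub>C x) = r + cmod c" for r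
    using that[rule_format, of 0] by (simp add: zero)
  have i_to_ii: "?s = 1 / 2 * onorm A" if "numerical_radius A = 1 / 2 * onorm A"
    using half_sqrt_onorm_anticomm_le[OF A nonzero] onorm_le_sqrt_onorm_anticomm[OF A] that
    by simp
  show ?thesis
  proof (intro conjI iffI)
    show "\<forall>c. numerical_radius (\<lambda>x. A x + c *\<^sub>C x) = 1 / 2 * onorm A + cmod c"
      if "numerical_radius A = 1 / 2 * onorm A"
      using shift i_to_ii[OF that] that by simp
    show "\<forall>c. numerical_radius (\<lambda>x. A x + c *\<^sub>C x) = ?s + cmod c"
      if "numerical_radius A = ?s"
      using shift[OF that] by blast
  qed (fact at_0)+
qed

end
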